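(* Let $\mathcal{A}$ be a non-degenerate conic in the projective plane over $\mathbb{K}\in\{\mathbb{R},\mathbb{C}\}$, and let $p_1,\dots,p_6$ be six distinct points on $\mathcal{A}$. Then $p_1,\dots,p_6$ are six consecutive points of a proper Poncelet heptagon (with circumscribed conic $\mathcal{A}$) if and only if \[[36][24][56][35][12][14]=[13][45][26][15][46][23].\]
   Context: Poncelet chains: given conics $\mathcal{A}$ (outer) and $\mathcal{B}$ (inner), a Poncelet chain is a sequence $p_1,p_2,\dots$ of points on $\mathcal{A}$ obtained as follows: $l_1$ is a tangent to $\mathcal{B}$ through $p_1$; $p_{i+1}$ is the intersection of $l_i$ with $\mathcal{A}$ other than $p_i$; $l_{i+1}$ is the tangent to $\mathcal{B}$ through $p_{i+1}$ other than $l_i$. If the chain closes after $n$ steps ($p_{i+n}=p_i$ for all $i$), then $p_1,\dots,p_n$ is a Poncelet $n$-gon; it is proper if all its $n$ points are distinct. A Poncelet heptagon is a Poncelet $7$-gon. Bracket notation: fix a projective parametrization of $\mathcal{A}$ by $\mathbb{KP}^1$ (e.g. via stereographic projection from a point of $\mathcal{A}$), so each point $p_i$ on $\mathcal{A}$ has homogeneous coordinates $v_i\in\mathbb{K}^2\setminus\{0\}$; writing $p_i$ as $i$, $[ij]:=\det(v_i,v_j)$. The equation is multihomogeneous and independent of the choices made. *)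

theory Defs
  imports "HOL-Analysis.Analysis"
begin

(* The projective space of one-dimensional subspaces of 'a^'n.  The value of proj at 0 is
   unspecified. *)

definition same_ray :: "'a::field ^ 'n \<Rightarrow> 'a ^ 'n \<Rightarrow> bool" where
  "same_ray v w \<longleftrightarrow> v \<noteq> 0 \<and> (\<exists>c. c \<noteq> 0 \<and> w = c *s v)"

lemma same_ray_refl: "v \<noteq> 0 \<Longrightarrow> same_ray v v"
  unfolding same_ray_def by (intro conjI exI[of _ 1]) simp_all

lemma same_ray_part_equivp: "part_equivp (same_ray :: 'a::field ^ 'n \<Rightarrow> 'a ^ 'n \<Rightarrow> bool)"
proof (rule part_equivpI)
  have "same_ray (axis undefined 1) (axis undefined 1 :: 'a ^ 'n)"
    by (rule same_ray_refl) (simp add: axis_eq_0_iff)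
  then show "\<exists>v :: 'a ^ 'n. same_ray v v" by blast
  show "symp (same_ray :: 'a ^ 'n \<Rightarrow> _)"
  proof (rule sympI)
    fix v w :: "'a ^ 'n"
    assume "same_ray v w"
    then obtain c where "v \<noteq> 0" "c \<noteq> 0" "w = c *s v"
      by (auto simp: same_ray_def)
    then have "w \<noteq> 0" "inverse c \<noteq> 0" "v = inverse c *s w"
      by (simp_all add: vector_smult_assoc)
    then show "same_ray w v"
      unfolding same_ray_def by blast
  qed
  show "transp (same_ray :: 'a ^ 'n \<Rightarrow> _)"
  proof (rule transpI)
    fix u v w :: "'a ^ 'n"
    assume "same_ray u v" "same_ray v w"
    then obtain c d where "u \<noteq> 0" "c \<noteq> 0" "v = c *s u" "d \<noteq> 0" "w = d *s v"
      by (auto simp: same_ray_def)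
    then have "u \<noteq> 0" "d * c \<noteq> 0" "w = (d * c) *s u"
      by (simp_all add: vector_smult_assoc)
    then show "same_ray u w"
      unfolding same_ray_def by blast
  qed
qed

quotient_type (overloaded) ('a, 'n) proj_space =
   "'a::field ^ 'n::finite" / partial: same_ray
  morphisms rep_proj proj
  by (rule same_ray_part_equivp)

type_synonym 'a point = "('a, 3) proj_space"

(* A line is given by its homogeneous coordinates. *)
type_synonym 'a line = "('a, 3) proj_space"

lemma proj_eq_iff:
  fixes v w :: "'a::field ^ 'n"
  assumes "v \<noteq> 0" and "w \<noteq> 0"
  shows "proj v = proj w \<longleftrightarrow> (\<exists>c. c \<noteq> 0 \<and> w = c *s v)"
proof -
  have "same_ray v v" "same_ray w w"
    using assms by (simp_all add: same_ray_refl)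
  then show ?thesis
    using Quotient_rel[OF Quotient_proj_space, of v w] assms by (auto simp: same_ray_def)
qed

lift_definition incident :: "'a::field point \<Rightarrow> 'a line \<Rightarrow> bool"
  is "\<lambda>q l. scalar_product q l = 0"
proof -
  fix q q' l l' :: "'a ^ 3"
  assume "same_ray q q'" "same_ray l l'"
  then obtain c d where "c \<noteq> 0" "q' = c *s q" "d \<noteq> 0" "l' = d *s l"
    by (auto simp: same_ray_def)
  moreover have "scalar_product (c *s q) (d *s l) = (c * d) * scalar_product q l"
    by (simp add: scalar_product_def sum_3 algebra_simps)
  ultimately show "(scalar_product q l = 0) = (scalar_product q' l' = 0)"
    by simp
qed

lemma incident_proj:
  assumes "q \<noteq> 0" and "l \<noteq> 0"
  shows "incident (proj q) (proj l) \<longleftrightarrow> scalar_product q l = 0"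
  using assms by (intro incident.abs_eq) (simp_all add: same_ray_refl)

(* A conic is represented by a symmetric matrix C, as the locus of q^T C q = 0. *)

definition nondegenerate_conic :: "'a::field ^ 3 ^ 3 \<Rightarrow> bool" where
  "nondegenerate_conic C \<longleftrightarrow> transpose C = C \<and> det C \<noteq> 0"

definition conic_points :: "'a::field ^ 3 ^ 3 \<Rightarrow> 'a point set" where
  "conic_points C = {proj q | q. q \<noteq> 0 \<and> scalar_product q (C *v q) = 0}"

(* The tangent at a point q of the conic is the polar line C q. *)
definition conic_tangents :: "'a::field ^ 3 ^ 3 \<Rightarrow> 'a line set" where
  "conic_tangents C =
     {proj (C *v q) | q. q \<noteq> 0 \<and> C *v q \<noteq> 0 \<and> scalar_product q (C *v q) = 0}"

(* Intersection points and tangents are counted with multiplicity: if l i is tangent to A, the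
   "other" intersection point is p i itself, and if p (i + 1) lies on B, the "other" tangent
   through it is l i itself.  The two set equations say exactly this.  The chain starts at
   index 1; the values at index 0 are irrelevant. *)
definition poncelet_chain ::
  "'a::field ^ 3 ^ 3 \<Rightarrow> 'a ^ 3 ^ 3 \<Rightarrow> (nat \<Rightarrow> 'a point) \<Rightarrow> (nat \<Rightarrow> 'a line) \<Rightarrow> bool" where
  "poncelet_chain A B p l \<longleftrightarrow>
     (\<forall>i\<ge>1. p i \<in> conic_points A \<and> l i \<in> conic_tangents B \<and>
        {q \<in> conic_points A. incident q (l i)} = {p i, p (i + 1)} \<and>
        {m \<in> conic_tangents B. incident (p (i + 1)) m} = {l i, l (i + 1)})"

definition poncelet_polygon :: "nat \<Rightarrow> 'a::field ^ 3 ^ 3 \<Rightarrow> (nat \<Rightarrow> 'a point) \<Rightarrow> bool" where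
  "poncelet_polygon n A p \<longleftrightarrow>
     (\<exists>B l. nondegenerate_conic B \<and> poncelet_chain A B p l) \<and> (\<forall>i\<ge>1. p (i + n) = p i)"

definition proper_poncelet_polygon ::
  "nat \<Rightarrow> 'a::field ^ 3 ^ 3 \<Rightarrow> (nat \<Rightarrow> 'a point) \<Rightarrow> bool" where
  "proper_poncelet_polygon n A p \<longleftrightarrow> poncelet_polygon n A p \<and> inj_on p {1..n}"

definition veronese :: "'a::field ^ 2 \<Rightarrow> 'a ^ 3" where
  "veronese v = vector [(v $ 1)\<^sup>2, v $ 1 * v $ 2, (v $ 2)\<^sup>2]"

(* A projective parametrization of a non-degenerate conic is given by three linearly independent
   binary quadratic forms, the rows of M in the monomial basis.  Inverse stereographic
   projections have this form. *)
definition conic_parametrization ::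
  "'a::field ^ 3 ^ 3 \<Rightarrow> (('a, 2) proj_space \<Rightarrow> 'a point) \<Rightarrow> bool" where
  "conic_parametrization A \<phi> \<longleftrightarrow>
     bij_betw \<phi> UNIV (conic_points A) \<and>
     (\<exists>M. invertible M \<and> (\<forall>v. v \<noteq> 0 \<longrightarrow> \<phi> (proj v) = proj (M *v veronese v)))"

definition bracket :: "(nat \<Rightarrow> 'a::field ^ 2) \<Rightarrow> nat \<Rightarrow> nat \<Rightarrow> 'a" where
  "bracket v i j = det (vector [v i, v j] :: 'a ^ 2 ^ 2)"

end

theory Submission
  imports Defs
begin

text \<open>In the parameter of \<open>A\<close>, a line is a binary quadratic form (with the parameters of its two
  intersection points as roots) and the dual conic of \<open>B\<close> is a quadratic form \<open>Q\<close> on these forms.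
  The chord from \<open>x\<close> to \<open>y\<close> touches \<open>B\<close> iff \<open>F x y = 0\<close> for a symmetric biquadratic \<open>F\<close>, and
  consecutive points of a chain satisfy \<open>F i y = a\<^sub>i [i-1,y] [i+1,y]\<close>.  Comparing \<open>F i j = F j i\<close>
  for \<open>i \<in> {1, 6}\<close>, \<open>j \<in> {3, 4}\<close> and eliminating the \<open>a\<^sub>i\<close> and the seventh point gives the equation.
  Conversely, there is a \<open>Q\<close> vanishing on the chords 12, 23, 34, 45, 56; it is non-degenerate unless
  12, 34, 56 are concurrent, which the equation excludes, and by the same elimination the second
  roots of \<open>F 1\<close> and \<open>F 6\<close> coincide.\<close>

section \<open>Brackets and binary quadratic forms\<close>

definition wedge :: "'a::field ^ 2 \<Rightarrow> 'a ^ 2 \<Rightarrow> 'a" where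
  "wedge u w = u $ 1 * w $ 2 - u $ 2 * w $ 1"

text \<open>A vector \<open>k\<close> stands for the binary quadratic form
  \<open>k\<^sub>1 x\<^sup>2 + k\<^sub>2 x y + k\<^sub>3 y\<^sup>2\<close>.\<close>

definition root_form :: "'a::field ^ 2 \<Rightarrow> 'a ^ 2 \<Rightarrow> 'a ^ 3" where
  "root_form u w = vector [u $ 2 * w $ 2, - (u $ 1 * w $ 2 + u $ 2 * w $ 1), u $ 1 * w $ 1]"

text \<open>The symmetric biquadratic form F of the outline. It is homogeneous of degree two in each
  argument, so whether it vanishes depends only on the two points.\<close>

definition pairing :: "'a::field ^ 3 ^ 3 \<Rightarrow> 'a ^ 2 \<Rightarrow> 'a ^ 2 \<Rightarrow> 'a" where
  "pairing Q u w = scalar_product (root_form u w) (Q *v root_form u w)"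

lemma vec3_eqI:
  fixes a b :: "'a ^ 3"
  assumes "a $ 1 = b $ 1" "a $ 2 = b $ 2" "a $ 3 = b $ 3"
  shows "a = b"
  using assms by (simp add: vec_eq_iff forall_3)

lemma vec2_eq_0_iff: "(v :: 'a::zero ^ 2) = 0 \<longleftrightarrow> v $ 1 = 0 \<and> v $ 2 = 0"
  by (simp add: vec_eq_iff forall_2)

lemma bracket_eq_wedge: "bracket v i j = wedge (v i) (v j)"
  by (simp add: bracket_def wedge_def det_2)

lemma wedge_self [simp]: "wedge u u = 0"
  by (simp add: wedge_def)

lemma wedge_zero [simp]: "wedge 0 w = 0" "wedge u 0 = 0"
  by (simp_all add: wedge_def)

lemma wedge_commute: "wedge u w = - wedge w u"
  by (simp add: wedge_def)

lemma wedge_eq_0_commute: "wedge u w = 0 \<longleftrightarrow> wedge w u = 0"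
  using wedge_commute[of u w] by simp

lemma wedge_plucker: "wedge a b * wedge c d - wedge a c * wedge b d + wedge a d * wedge b c = 0"
  by (simp add: wedge_def algebra_simps)

lemma wedge_eq_0_imp_smult:
  assumes "wedge u w = 0" "u \<noteq> 0"
  obtains c where "w = c *s u"
proof (cases "u $ 1 = 0")
  case True
  with assms have "u $ 2 \<noteq> 0" "w $ 1 = 0"
    by (auto simp: wedge_def vec2_eq_0_iff)
  then have "w = (w $ 2 / u $ 2) *s u"
    using True by (simp add: vec_eq_iff forall_2)
  then show ?thesis by (rule that)
next
  case False
  then have "w = (w $ 1 / u $ 1) *s u"
    using assms by (auto simp: vec_eq_iff forall_2 wedge_def field_simps)
  then show ?thesis by (rule that)
qed

lemma proj_eq_iff_wedge:
  assumes "u \<noteq> 0" "w \<noteq> 0"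
  shows "proj u = proj w \<longleftrightarrow> wedge u w = 0"
proof
  assume "proj u = proj w"
  then obtain c where "w = c *s u" using assms by (auto simp: proj_eq_iff)
  then show "wedge u w = 0" by (simp add: wedge_def)
next
  assume "wedge u w = 0"
  then obtain c where c: "w = c *s u" using wedge_eq_0_imp_smult assms by blast
  moreover have "c \<noteq> 0" using c assms by auto
  ultimately show "proj u = proj w" using assms by (auto simp: proj_eq_iff)
qed

text \<open>Since \<open>proj\<close> is unspecified at 0, points are always unpacked through a
  nonzero representative.\<close>

lemma proj_exhaust:
  obtains x :: "'a::field ^ 'n::finite" where "x \<noteq> 0" "P = proj x"
proof -
  have "\<exists>x. x \<noteq> 0 \<and> P = proj x"
    by (induction P rule: proj_space.abs_induct) (auto simp: same_ray_def)
  then show ?thesis using that by blast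
qed

lemma root_form_commute: "root_form u w = root_form w u"
  by (rule vec3_eqI) (simp_all add: root_form_def algebra_simps)

lemma root_form_smult [simp]: "root_form u (c *s w) = c *s root_form u w"
  by (rule vec3_eqI) (simp_all add: root_form_def algebra_simps)

text \<open>Scalar product with \<open>veronese x\<close> evaluates a form at x; the factorization
  shows that u and w are the roots of \<open>root_form u w\<close>.\<close>

lemma veronese_root_form: "scalar_product (veronese x) (root_form u w) = wedge u x * wedge w x"
  by (simp add: scalar_product_def sum_3 veronese_def root_form_def wedge_def
      power2_eq_square algebra_simps)

lemma root_form_nonzero:
  assumes "u \<noteq> 0" "w \<noteq> 0"
  shows "root_form u w \<noteq> 0"
proof
  assume "root_form u w = 0"
  then have "u $ 2 * w $ 2 = 0" "u $ 1 * w $ 2 + u $ 2 * w $ 1 = 0" "u $ 1 * w $ 1 = 0"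
    by (simp_all add: root_form_def vec_eq_iff forall_3) (metis neg_eq_iff_add_eq_0)
  then show False using assms by (auto simp: vec2_eq_0_iff)
qed

lemma veronese_nonzero: "x \<noteq> 0 \<Longrightarrow> veronese x \<noteq> 0"
  by (auto simp: veronese_def vec_eq_iff forall_3 forall_2)

text \<open>A form with root x is divisible by a linear form with that root, and w is the root of
  the cofactor. For \<open>k = 0\<close> the witness w is 0.\<close>

lemma form_with_root:
  assumes "scalar_product (veronese x) k = 0" "x \<noteq> 0"
  obtains w where "k = root_form x w"
proof (cases "x $ 1 = 0")
  case True
  with assms have "x $ 2 \<noteq> 0" "k $ 3 = 0"
    by (auto simp: vec2_eq_0_iff scalar_product_def sum_3 veronese_def)
  then have "k = root_form x (vector [- k $ 2 / x $ 2, k $ 1 / x $ 2])"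
    using True by (intro vec3_eqI) (simp_all add: root_form_def)
  then show ?thesis by (rule that)
next
  case False
  have *: "(x $ 1)\<^sup>2 * k $ 1 + x $ 1 * x $ 2 * k $ 2 + (x $ 2)\<^sup>2 * k $ 3 = 0"
    using assms by (simp add: scalar_product_def sum_3 veronese_def)
  \<comment> \<open>The witness comes from comparing the last two coefficients; agreement of the
    first one is the vanishing at x.\<close>
  have "k $ 1 = (x $ 2 * (- k $ 2 * x $ 1 - x $ 2 * k $ 3)) / (x $ 1)\<^sup>2"
    using False * by (simp add: field_simps eq_neg_iff_add_eq_0 power2_eq_square)
  then have "k = root_form x (vector [k $ 3 / x $ 1, (- k $ 2 - x $ 2 * k $ 3 / x $ 1) / x $ 1])"
    using False by (intro vec3_eqI) (simp_all add: root_form_def field_simps power2_eq_square)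
  then show ?thesis by (rule that)
qed

text \<open>Dividing out the root u leaves a cofactor whose root can only be w.\<close>

lemma form_with_two_roots:
  assumes "scalar_product (veronese u) k = 0" "scalar_product (veronese w) k = 0" "wedge u w \<noteq> 0"
  obtains c where "k = c *s root_form u w"
proof -
  have nz: "u \<noteq> 0" "w \<noteq> 0" using assms(3) by auto
  obtain z where z: "k = root_form u z" using form_with_root assms(1) nz by blast
  have "wedge z w = 0" using assms(2,3) z by (simp add: veronese_root_form)
  then have "wedge w z = 0" by (simp add: wedge_commute[of w])
  then obtain c where "z = c *s w" using wedge_eq_0_imp_smult nz by blast
  then show ?thesis using that[of c] z by simp
qed

section \<open>Quadratic forms evaluated on root forms\<close>

lemma scalar_product_commute: "scalar_product x y = scalar_product y (x :: 'a::field ^ 'n)"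
  by (simp add: scalar_product_def mult.commute)

lemma scalar_product_add:
  "scalar_product (x + y) z = scalar_product x z + scalar_product y (z :: 'a::field ^ 'n)"
  "scalar_product z (x + y) = scalar_product z x + scalar_product z y"
  by (simp_all add: scalar_product_def sum.distrib algebra_simps)

lemma scalar_product_smult:
  "scalar_product (c *s x) z = c * scalar_product x (z :: 'a::field ^ 'n)"
  "scalar_product z (c *s x) = c * scalar_product z x"
  by (simp_all add: scalar_product_def sum_distrib_left algebra_simps)

lemma scalar_product_transpose:
  fixes x :: "'a::field ^ 'n"
  shows "scalar_product (A *v x) y = scalar_product x (transpose A *v y)"
  unfolding scalar_product_def matrix_vector_mult_def transpose_def
  by (simp add: sum_distrib_left sum_distrib_right mult_ac) (rule sum.swap)

lemma pairing_commute: "pairing Q u w = pairing Q w u"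
  by (simp add: pairing_def root_form_commute)

lemma matrix_vector_smult: "(A :: 'a::field ^ 'n ^ 'm) *v (c *s x) = c *s (A *v x)"
  by (simp add: matrix_vector_mult_def vec_eq_iff sum_distrib_left mult_ac)

lemma root_form_expand:
  "root_form u y = y $ 1 *s root_form u (vector [1, 0]) + y $ 2 *s root_form u (vector [0, 1])"
  by (rule vec3_eqI) (simp_all add: root_form_def algebra_simps)

text \<open>Because \<open>root_form u y\<close> is linear in y, a row of F is itself a binary
  quadratic form in y; k is its coefficient vector.\<close>

lemma pairing_row:
  obtains k where "\<And>y. pairing Q u y = scalar_product (veronese y) k"
proof
  fix y
  let ?E = "root_form u (vector [1, 0])" and ?E' = "root_form u (vector [0, 1])"
  show "pairing Q u y = scalar_product (veronese y)
    (vector [scalar_product ?E (Q *v ?E), scalar_product ?E (Q *v ?E') + scalar_product ?E' (Q *v ?E),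
             scalar_product ?E' (Q *v ?E')])"
    unfolding pairing_def root_form_expand[of u y] scalar_product_def[of "veronese y"]
    by (simp add: matrix_vector_right_distrib matrix_vector_smult scalar_product_add
        scalar_product_smult sum_3 veronese_def power2_eq_square algebra_simps)
qed

text \<open>Serves the end points 1 and 6, of which only one neighbour is known: w is the second
  root of the row.\<close>

lemma pairing_row_residual:
  assumes "pairing Q u a = 0" "a \<noteq> 0"
  obtains w where "\<And>y. pairing Q u y = wedge a y * wedge w y"
proof -
  obtain k where k: "\<And>y. pairing Q u y = scalar_product (veronese y) k"
    using pairing_row by blast
  then obtain w where "k = root_form a w" using form_with_root assms by metis
  then show ?thesis using that[of w] k by (simp add: veronese_root_form)
qed

text \<open>Gives the row of a point with both neighbours known. That c is nonzero comes separately
  from \<open>pairing_row_nonzero\<close>.\<close>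

lemma pairing_row_two_roots:
  assumes "pairing Q u a = 0" "pairing Q u b = 0" "wedge a b \<noteq> 0"
  obtains c where "\<And>y. pairing Q u y = c * wedge a y * wedge b y"
proof -
  obtain k where k: "\<And>y. pairing Q u y = scalar_product (veronese y) k"
    using pairing_row by blast
  then obtain c where "k = c *s root_form a b" using form_with_two_roots assms by metis
  then show ?thesis
    using that[of c] k by (simp add: veronese_root_form scalar_product_smult mult.assoc)
qed

lemma matrix_vector_mult_eq_0:
  fixes Q :: "'a::field ^ 'n ^ 'n"
  assumes "det Q \<noteq> 0" "Q *v x = 0"
  shows "x = 0"
proof -
  obtain R where "R ** Q = mat 1"
    using assms(1) unfolding invertible_det_nz[symmetric] invertible_def by blast
  then have "x = R *v (Q *v x)"
    by (simp add: matrix_vector_mul_assoc)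
  then show ?thesis using assms(2) by simp
qed

text \<open>A two-dimensional space of forms \<open>root_form u y\<close> cannot be isotropic for a non-degenerate
  quadratic form in three variables.\<close>

lemma pairing_row_nonzero:
  fixes Q :: "'a::field_char_0 ^ 3 ^ 3"
  assumes sym: "transpose Q = Q" and nz: "det Q \<noteq> 0" and "u \<noteq> 0"
  obtains y where "pairing Q u y \<noteq> 0"
proof (rule ccontr)
  assume "\<not> thesis"
  then have zero: "pairing Q u y = 0" for y using that by blast
  let ?e = "vector [1, 0] :: 'a ^ 2" and ?e' = "vector [0, 1] :: 'a ^ 2"
  let ?E = "root_form u ?e" and ?E' = "root_form u ?e'"
  have EE: "scalar_product ?E (Q *v ?E) = 0" and EE': "scalar_product ?E' (Q *v ?E') = 0"
    using zero[of ?e] zero[of ?e'] by (simp_all add: pairing_def)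
  have swap: "scalar_product ?E' (Q *v ?E) = scalar_product ?E (Q *v ?E')"
    using scalar_product_transpose[of Q ?E' ?E] sym by (simp add: scalar_product_commute)
  \<comment> \<open>Polarization: the zero at (1, 1) forces the mixed product to vanish.\<close>
  have "root_form u (vector [1, 1]) = ?E + ?E'"
    using root_form_expand[of u "vector [1, 1]"] by simp
  then have "2 * scalar_product ?E (Q *v ?E') = 0"
    using zero[of "vector [1, 1]"] EE EE' swap
    by (simp add: pairing_def matrix_vector_right_distrib scalar_product_add)
  then have mixed: "scalar_product ?E (Q *v ?E') = 0" by simp
  \<comment> \<open>All forms \<open>root_form u y\<close> vanish at u, so the orthogonal complement
    of their span is the line through \<open>veronese u\<close>. Thus Q maps a two-dimensional space
    into a line.\<close>
  have orth: "\<exists>s. a = s *s veronese u"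
    if "scalar_product ?E a = 0" "scalar_product ?E' a = 0" for a
  proof -
    have 1: "u $ 1 * a $ 3 = u $ 2 * a $ 2" "u $ 1 * a $ 2 = u $ 2 * a $ 1"
      using that by (simp_all add: scalar_product_def sum_3 root_form_def)
    show ?thesis
    proof (cases "u $ 1 = 0")
      case True
      with \<open>u \<noteq> 0\<close> have "u $ 2 \<noteq> 0" by (simp add: vec2_eq_0_iff)
      with 1 True show ?thesis
        by (intro exI[of _ "a $ 3 / (u $ 2)\<^sup>2"] vec3_eqI) (simp_all add: veronese_def)
    next
      case False
      then have 2: "a $ 2 = u $ 2 * a $ 1 / u $ 1" using 1 by (simp add: field_simps)
      have 3: "a $ 3 = u $ 2 * a $ 2 / u $ 1" using 1 False by (simp add: field_simps)
      show ?thesis using False 3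
        by (intro exI[of _ "a $ 1 / (u $ 1)\<^sup>2"] vec3_eqI)
          (simp_all add: veronese_def 2 power2_eq_square)
    qed
  qed
  obtain s where s: "Q *v ?E = s *s veronese u" using orth EE mixed swap by metis
  obtain t where t: "Q *v ?E' = t *s veronese u" using orth EE' mixed by metis
  \<comment> \<open>The combination of the two basis forms that Q must send to 0.\<close>
  have "Q *v root_form u (vector [t, - s]) = t *s (Q *v ?E) + (- s) *s (Q *v ?E')"
    unfolding root_form_expand[of u "vector [t, - s]"]
    by (simp only: matrix_vector_right_distrib matrix_vector_smult vector_2)
  also have "\<dots> = 0"
    by (simp only: s t) (simp add: vec_eq_iff algebra_simps)
  finally have "Q *v root_form u (vector [t, - s]) = 0" .
  then have "root_form u (vector [t, - s]) = 0" by (rule matrix_vector_mult_eq_0[OF nz])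
  then have "vector [t, - s] = (0 :: 'a ^ 2)" using root_form_nonzero \<open>u \<noteq> 0\<close> by blast
  then have "s = 0" by (simp add: vec2_eq_0_iff)
  then have "?E = 0" using s matrix_vector_mult_eq_0[OF nz, of ?E] by simp
  moreover have "?e \<noteq> 0" by (simp add: vec2_eq_0_iff)
  ultimately show False using root_form_nonzero \<open>u \<noteq> 0\<close> by blast
qed

section \<open>The dual conic\<close>

lemma transpose_inverse:
  fixes Q :: "'a::field ^ 'n ^ 'n"
  assumes "transpose Q = Q" "Q ** Q' = mat 1"
  shows "transpose Q' = Q'"
proof -
  have *: "transpose Q' ** Q = mat 1"
    using arg_cong[OF assms(2), of transpose] by (simp add: matrix_transpose_mul assms(1))
  have "transpose Q' = transpose Q' ** (Q ** Q')" by (simp add: assms(2))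
  also have "\<dots> = Q'" by (simp add: matrix_mul_assoc *)
  finally show ?thesis .
qed

text \<open>The tangents of B form the conic of the inverse matrix: substituting
  \<open>m = B *v q\<close> turns the equation of B at q into that of \<open>B'\<close> at
  m.\<close>

lemma conic_tangents_iff:
  assumes sym: "transpose B = B" and inv: "B ** B' = mat 1" and m: "m \<noteq> 0"
  shows "proj m \<in> conic_tangents B \<longleftrightarrow> scalar_product m (B' *v m) = 0"
proof -
  have inv': "B' ** B = mat 1" using inv by (simp add: matrix_left_right_inverse)
  have B'B: "B' *v (B *v x) = x" for x by (simp add: matrix_vector_mul_assoc inv')
  have BB': "B *v (B' *v x) = x" for x by (simp add: matrix_vector_mul_assoc inv)
  show ?thesis
  proof
    assume "proj m \<in> conic_tangents B"
    then obtain q where q: "proj (B *v q) = proj m" "B *v q \<noteq> 0" "scalar_product q (B *v q) = 0"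
      unfolding conic_tangents_def by auto
    then obtain c where c: "m = c *s (B *v q)"
      using m by (auto simp: proj_eq_iff)
    have "B' *v m = c *s q" unfolding c by (simp only: matrix_vector_smult B'B)
    then show "scalar_product m (B' *v m) = 0"
      using q(3) by (simp add: c scalar_product_smult scalar_product_commute[of _ q])
  next
    assume *: "scalar_product m (B' *v m) = 0"
    \<comment> \<open>The point of contact is the pole of m.\<close>
    have "B' *v m \<noteq> 0" using m BB'[of m] by auto
    then show "proj m \<in> conic_tangents B"
      unfolding conic_tangents_def using * m
      by (intro CollectI exI[of _ "B' *v m"]) (simp add: BB' scalar_product_commute)
  qed
qed

declare transpose_matrix_vector [simp del]

section \<open>Points and lines in the parameter of the outer conic\<close>

locale parametrized_conic =
  fixes A :: "'a::field_char_0 ^ 3 ^ 3" and \<phi> :: "('a, 2) proj_space \<Rightarrow> 'a point"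
    and M N :: "'a ^ 3 ^ 3"
  assumes bij: "bij_betw \<phi> UNIV (conic_points A)"
    and MN: "M ** N = mat 1"
    and \<phi>: "v \<noteq> 0 \<Longrightarrow> \<phi> (proj v) = proj (M *v veronese v)"
begin

text \<open>The line whose intersection with \<open>A\<close> is given, in the parameter, by the roots of the
  form \<open>k\<close>.\<close>

definition line_of :: "'a ^ 3 \<Rightarrow> 'a ^ 3" where
  "line_of k = transpose N *v k"

lemma NM: "N ** M = mat 1"
  using MN by (simp add: matrix_left_right_inverse)

lemma line_of_inverse: "line_of (transpose M *v m) = m" "transpose M *v line_of k = k"
  unfolding line_of_def
  by (simp_all only: matrix_vector_mul_assoc MN NM transpose_mat matrix_vector_mul_lid
      flip: matrix_transpose_mul)

lemma line_of_nonzero: "k \<noteq> 0 \<Longrightarrow> line_of k \<noteq> 0"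
  using line_of_inverse(2)[of k] by auto

lemma line_of_smult: "line_of (c *s k) = c *s line_of k"
  by (simp only: line_of_def matrix_vector_smult)

lemma line_exhaust:
  obtains k where "k \<noteq> 0" "l = proj (line_of k)"
proof -
  obtain m where m: "m \<noteq> 0" "l = proj m" by (rule proj_exhaust)
  show ?thesis
  proof (rule that)
    show "l = proj (line_of (transpose M *v m))" using m by (simp add: line_of_inverse)
    show "transpose M *v m \<noteq> 0" using m line_of_inverse(1)[of m] by (auto simp: line_of_def)
  qed
qed

text \<open>Points transform by \<open>M\<close> and lines by the transposed inverse, so incidence
  becomes the evaluation of k at x.\<close>

lemma incident_line_of:
  assumes "x \<noteq> 0" "k \<noteq> 0"
  shows "incident (\<phi> (proj x)) (proj (line_of k)) \<longleftrightarrow> scalar_product (veronese x) k = 0"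
proof -
  have "N *v (M *v veronese x) = veronese x" by (simp add: matrix_vector_mul_assoc NM)
  then have "M *v veronese x \<noteq> 0" using veronese_nonzero[OF assms(1)] by auto
  then show ?thesis
    using assms line_of_nonzero
    by (simp add: \<phi> incident_proj scalar_product_transpose line_of_inverse)
qed

lemma point_exhaust:
  assumes "q \<in> conic_points A"
  obtains x where "x \<noteq> 0" "q = \<phi> (proj x)"
proof -
  have "q \<in> range \<phi>" using assms bij by (simp add: bij_betw_def)
  then show ?thesis using that proj_exhaust by (metis imageE)
qed

lemma point_in_conic: "\<phi> P \<in> conic_points A"
  using bij by (auto simp: bij_betw_def)

lemma point_eq_iff:
  assumes "u \<noteq> 0" "w \<noteq> 0"
  shows "\<phi> (proj u) = \<phi> (proj w) \<longleftrightarrow> wedge u w = 0"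
  using bij assms by (simp add: bij_betw_def inj_eq proj_eq_iff_wedge)

text \<open>The form of such a line has two distinct known roots, which fix it up to a
  scalar.\<close>

lemma chord_unique:
  assumes "wedge u w \<noteq> 0" "incident (\<phi> (proj u)) l" "incident (\<phi> (proj w)) l"
  shows "l = proj (line_of (root_form u w))"
proof -
  have nz: "u \<noteq> 0" "w \<noteq> 0" using assms(1) by auto
  obtain k where k: "k \<noteq> 0" "l = proj (line_of k)" by (rule line_exhaust)
  then obtain c where c: "k = c *s root_form u w"
    using assms nz incident_line_of form_with_two_roots by metis
  with k(1) have "c \<noteq> 0" by auto
  moreover have "line_of k = c *s line_of (root_form u w)" by (simp add: c line_of_smult)
  ultimately show ?thesis
    using k nz by (simp only: k(2)) (metis proj_eq_iff line_of_nonzero root_form_nonzero)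
qed

text \<open>Pulling the dual conic of B back along \<open>line_of\<close> gives the quadratic form Q
  of the outline.\<close>

lemma conic_tangents_line_of:
  assumes "transpose B = B" "B ** B' = mat 1" "k \<noteq> 0"
  shows "proj (line_of k) \<in> conic_tangents B \<longleftrightarrow>
    scalar_product k ((N ** B' ** transpose N) *v k) = 0"
  using conic_tangents_iff[OF assms(1,2) line_of_nonzero[OF assms(3)]]
  by (simp add: line_of_def scalar_product_transpose matrix_vector_mul_assoc matrix_mul_assoc)

section \<open>Poncelet chains and the biquadratic form\<close>

lemma chain_step:
  assumes B: "transpose B = B" "B ** B' = mat 1" and chain: "poncelet_chain A B p l"
    and i: "i \<ge> 1" and p: "p i = \<phi> (proj u)" "p (i + 1) = \<phi> (proj w)"
    and uw: "wedge u w \<noteq> 0"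
  shows "pairing (N ** B' ** transpose N) u w = 0"
proof -
  have nz: "u \<noteq> 0" "w \<noteq> 0" using uw by auto
  have tangent: "l i \<in> conic_tangents B"
    and on_line: "{q \<in> conic_points A. incident q (l i)} = {p i, p (i + 1)}"
    using chain i unfolding poncelet_chain_def by blast+
  have "incident (p i) (l i)" "incident (p (i + 1)) (l i)"
    using on_line by blast+
  then have "l i = proj (line_of (root_form u w))"
    using chord_unique uw p by metis
  then show ?thesis
    using tangent conic_tangents_line_of[OF B root_form_nonzero[OF nz]] by (simp add: pairing_def)
qed

text \<open>All that the elimination needs from a chain. A single Q serves every index and every
  choice of representatives.\<close>

lemma chain_rows:
  assumes B: "nondegenerate_conic B" and chain: "poncelet_chain A B p l"
  obtains Q where
    "\<And>i u w z. \<lbrakk>i \<ge> 1; p i = \<phi> (proj u); p (i + 1) = \<phi> (proj w); p (i + 2) = \<phi> (proj z);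
       wedge u w \<noteq> 0; wedge w z \<noteq> 0; wedge u z \<noteq> 0\<rbrakk>
     \<Longrightarrow> \<exists>c. c \<noteq> 0 \<and> (\<forall>y. pairing Q w y = c * wedge u y * wedge z y)"
proof -
  have sym: "transpose B = B" and "det B \<noteq> 0" using B by (simp_all add: nondegenerate_conic_def)
  then obtain B' where B': "B ** B' = mat 1"
    unfolding invertible_det_nz[symmetric] invertible_def by blast
  define Q where "Q = N ** B' ** transpose N"
  have symB': "transpose B' = B'" using transpose_inverse sym B' by blast
  have symQ: "transpose Q = Q"
    by (simp add: Q_def matrix_transpose_mul symB' matrix_mul_assoc)
  have "det B * det B' = 1" "det M * det N = 1"
    using B' MN by (metis det_mul det_I)+
  then have detQ: "det Q \<noteq> 0"
    by (auto simp: Q_def det_mul)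
  show ?thesis
  proof (rule that[of Q])
    fix i u w z
    assume *: "i \<ge> 1" "p i = \<phi> (proj u)" "p (i + 1) = \<phi> (proj w)" "p (i + 2) = \<phi> (proj z)"
       "wedge u w \<noteq> 0" "wedge w z \<noteq> 0" "wedge u z \<noteq> 0"
    have "pairing Q u w = 0"
      using chain_step[OF sym B' chain _ *(2,3)] * by (simp add: Q_def)
    then have "pairing Q w u = 0" by (simp add: pairing_commute)
    moreover have "pairing Q w z = 0"
      using chain_step[OF sym B' chain, of "i + 1" w z] * by (simp add: Q_def)
    ultimately obtain c where c: "\<And>y. pairing Q w y = c * wedge u y * wedge z y"
      using pairing_row_two_roots *(7) by blast
    have "w \<noteq> 0" using * by auto
    then obtain y where "pairing Q w y \<noteq> 0"
      using pairing_row_nonzero[OF symQ detQ] by blast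
    then have "c \<noteq> 0" using c by auto
    with c show "\<exists>c. c \<noteq> 0 \<and> (\<forall>y. pairing Q w y = c * wedge u y * wedge z y)" by blast
  qed
qed

text \<open>Q is read as the dual of some B. A tangent through \<open>V (n + 1)\<close> is a root of
  the row of that point, and by \<open>gap\<close> the two neighbours exhaust the roots; this yields
  the tangent set equations.\<close>

lemma chain_of_pairing:
  assumes symQ: "transpose Q = Q" and detQ: "det Q \<noteq> 0"
    and adj: "\<And>n. wedge (V n) (V (n + 1)) \<noteq> 0" and gap: "\<And>n. wedge (V n) (V (n + 2)) \<noteq> 0"
    and zero: "\<And>n. pairing Q (V n) (V (n + 1)) = 0"
  shows "\<exists>B l. nondegenerate_conic B \<and> poncelet_chain A B (\<lambda>n. \<phi> (proj (V n))) l"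
proof -
  obtain Q' where Q': "Q ** Q' = mat 1"
    using detQ unfolding invertible_det_nz[symmetric] invertible_def by blast
  have Q'Q: "Q' ** Q = mat 1" using Q' by (simp add: matrix_left_right_inverse)
  have symQ': "transpose Q' = Q'" using transpose_inverse symQ Q' by blast
  \<comment> \<open>Solves \<open>Q = N ** B' ** transpose N\<close> for \<open>B'\<close>; B is the
    inverse of the solution.\<close>
  define B where "B = transpose N ** Q' ** N"
  define B' where "B' = M ** Q ** transpose M"
  have symB: "transpose B = B"
    by (simp add: B_def matrix_transpose_mul symQ' matrix_mul_assoc)
  have tr: "transpose M ** transpose N = mat 1" "transpose N ** transpose M = mat 1"
    by (simp_all add: MN NM flip: matrix_transpose_mul)
  have "B ** B' = transpose N ** (Q' ** ((N ** M) ** Q)) ** transpose M"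
    by (simp only: B_def B'_def matrix_mul_assoc)
  then have BB': "B ** B' = mat 1"
    by (simp add: NM Q'Q tr)
  have "N ** B' ** transpose N = (N ** M) ** Q ** (transpose M ** transpose N)"
    by (simp only: B'_def matrix_mul_assoc)
  then have Q: "N ** B' ** transpose N = Q" by (simp add: NM tr)
  have "det B * det B' = 1" using BB' by (metis det_mul det_I)
  then have ndB: "nondegenerate_conic B"
    using symB by (auto simp: nondegenerate_conic_def)
  have nz: "V n \<noteq> 0" for n using adj[of n] by auto
  have nzf: "root_form (V n) (V (n + 1)) \<noteq> 0" for n using nz root_form_nonzero by blast
  define l where "l n = proj (line_of (root_form (V n) (V (n + 1))))" for n
  have tangent: "l n \<in> conic_tangents B" for n
    using zero[of n] conic_tangents_line_of[OF symB BB' nzf]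
    by (simp add: Q l_def pairing_def)
  have on_line: "incident (\<phi> (proj x)) (l n) \<longleftrightarrow> wedge (V n) x = 0 \<or> wedge (V (n + 1)) x = 0"
    if "x \<noteq> 0" for x n
    using incident_line_of[OF that nzf] by (simp add: l_def veronese_root_form)
  have "{q \<in> conic_points A. incident q (l n)} = {\<phi> (proj (V n)), \<phi> (proj (V (n + 1)))}" for n
  proof (intro equalityI subsetI)
    fix q assume "q \<in> {q \<in> conic_points A. incident q (l n)}"
    then have "q \<in> conic_points A" "incident q (l n)" by auto
    moreover from this obtain x where "x \<noteq> 0" "q = \<phi> (proj x)" using point_exhaust by blast
    ultimately show "q \<in> {\<phi> (proj (V n)), \<phi> (proj (V (n + 1)))}"
      using on_line point_eq_iff nz by (metis insertCI)
  next
    fix q assume "q \<in> {\<phi> (proj (V n)), \<phi> (proj (V (n + 1)))}"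
    then show "q \<in> {q \<in> conic_points A. incident q (l n)}"
      using on_line[OF nz] by (auto simp: point_in_conic)
  qed
  moreover have "{m \<in> conic_tangents B. incident (\<phi> (proj (V (n + 1)))) m} = {l n, l (n + 1)}" for n
  proof (intro equalityI subsetI)
    fix m assume m: "m \<in> {m \<in> conic_tangents B. incident (\<phi> (proj (V (n + 1)))) m}"
    obtain k where k: "k \<noteq> 0" "m = proj (line_of k)" by (rule line_exhaust)
    then have "scalar_product (veronese (V (n + 1))) k = 0"
      using m incident_line_of[OF nz] by auto
    \<comment> \<open>The tangent m meets A at \<open>V (n + 1)\<close> and at y. Tangency puts y
      among the roots of the row; y is nonzero because k is.\<close>
    then obtain y where y: "k = root_form (V (n + 1)) y" using form_with_root nz by blast
    have "y \<noteq> 0" using k y root_form_smult[of "V (n + 1)" 0 0] by auto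
    have "pairing Q (V (n + 1)) y = 0"
      using m k conic_tangents_line_of[OF symB BB' k(1)] by (simp add: Q pairing_def y)
    moreover obtain c where
      c: "\<And>y. pairing Q (V (n + 1)) y = c * wedge (V n) y * wedge (V (n + 2)) y"
      using pairing_row_two_roots[of Q "V (n + 1)" "V n" "V (n + 2)"] zero[of n] zero[of "n + 1"]
        gap[of n] by (auto simp: pairing_commute[of _ "V (Suc n)" "V n"])
    moreover have "c \<noteq> 0"
      using pairing_row_nonzero[OF symQ detQ nz[of "n + 1"]] c by auto
    ultimately have "wedge (V n) y = 0 \<or> wedge (V (n + 2)) y = 0" by auto
    moreover have "m = proj (line_of (root_form (V (n + 1)) x))" if x: "wedge x y = 0" "x \<noteq> 0" for x
    proof -
      obtain d where d: "y = d *s x" using wedge_eq_0_imp_smult x by blast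
      have "line_of k = d *s line_of (root_form (V (n + 1)) x)"
        by (simp add: y d line_of_smult)
      moreover have "d \<noteq> 0" using d \<open>y \<noteq> 0\<close> by auto
      ultimately show ?thesis
        using k x nz by (simp only: k(2)) (metis proj_eq_iff line_of_nonzero root_form_nonzero)
    qed
    ultimately show "m \<in> {l n, l (n + 1)}"
      using nz by (auto simp: l_def root_form_commute[of "V (Suc n)" "V n"])
  next
    fix m assume "m \<in> {l n, l (n + 1)}"
    then show "m \<in> {m \<in> conic_tangents B. incident (\<phi> (proj (V (n + 1)))) m}"
      using tangent on_line[OF nz] by auto
  qed
  ultimately have "poncelet_chain A B (\<lambda>n. \<phi> (proj (V n))) l"
    using tangent by (simp add: poncelet_chain_def point_in_conic)
  with ndB show ?thesis by blast
qed

end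

section \<open>Elimination from the rows, and a form through five chords\<close>

text \<open>Symmetry of F at the pairs (1,3) and (6,3) eliminates a3 and the bracket [73]; the pairs
  (1,4) and (6,4) eliminate a4 and [74]. Comparing the two results eliminates a1 and a6.\<close>

lemma heptagon_equation_of_rows:
  fixes v1 v2 v3 v4 v5 v6 v7 :: "'a::field ^ 2"
  assumes a: "a1 \<noteq> 0" "a3 \<noteq> 0" "a4 \<noteq> 0" "a6 \<noteq> 0"
    and r1: "\<And>y. pairing Q v1 y = a1 * wedge v7 y * wedge v2 y"
    and r3: "\<And>y. pairing Q v3 y = a3 * wedge v2 y * wedge v4 y"
    and r4: "\<And>y. pairing Q v4 y = a4 * wedge v3 y * wedge v5 y"
    and r6: "\<And>y. pairing Q v6 y = a6 * wedge v5 y * wedge v7 y"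
    and nz: "wedge v7 v3 \<noteq> 0" "wedge v7 v4 \<noteq> 0"
  shows "wedge v3 v6 * wedge v2 v4 * wedge v5 v6 * wedge v3 v5 * wedge v1 v2 * wedge v1 v4 =
         wedge v1 v3 * wedge v4 v5 * wedge v2 v6 * wedge v1 v5 * wedge v4 v6 * wedge v2 v3"
proof -
  have e13: "a1 * wedge v7 v3 * wedge v2 v3 = a3 * wedge v2 v1 * wedge v4 v1"
    using pairing_commute[of Q v1 v3] unfolding r1 r3 .
  have e63: "a6 * wedge v5 v3 * wedge v7 v3 = a3 * wedge v2 v6 * wedge v4 v6"
    using pairing_commute[of Q v6 v3] unfolding r6 r3 .
  have e14: "a1 * wedge v7 v4 * wedge v2 v4 = a4 * wedge v3 v1 * wedge v5 v1"
    using pairing_commute[of Q v1 v4] unfolding r1 r4 .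
  have e64: "a6 * wedge v5 v4 * wedge v7 v4 = a4 * wedge v3 v6 * wedge v5 v6"
    using pairing_commute[of Q v6 v4] unfolding r6 r4 .
  have "(a3 * wedge v7 v3) * (a1 * wedge v2 v3 * wedge v2 v6 * wedge v4 v6) =
      (a3 * wedge v7 v3) * (a6 * wedge v2 v1 * wedge v4 v1 * wedge v5 v3)"
    using e13 e63 by algebra
  then have 3: "a1 * wedge v2 v3 * wedge v2 v6 * wedge v4 v6 =
      a6 * wedge v2 v1 * wedge v4 v1 * wedge v5 v3"
    using a nz by simp
  have "(a4 * wedge v7 v4) * (a1 * wedge v2 v4 * wedge v3 v6 * wedge v5 v6) =
      (a4 * wedge v7 v4) * (a6 * wedge v3 v1 * wedge v5 v1 * wedge v5 v4)"
    using e14 e64 by algebra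
  then have 4: "a1 * wedge v2 v4 * wedge v3 v6 * wedge v5 v6 =
      a6 * wedge v3 v1 * wedge v5 v1 * wedge v5 v4"
    using a nz by simp
  have "(a1 * a6) * (wedge v2 v4 * wedge v3 v6 * wedge v5 v6 * wedge v2 v1 * wedge v4 v1 * wedge v5 v3) =
     (a1 * a6) * (wedge v2 v3 * wedge v2 v6 * wedge v4 v6 * wedge v3 v1 * wedge v5 v1 * wedge v5 v4)"
    using 3 4 by algebra
  then have "wedge v2 v4 * wedge v3 v6 * wedge v5 v6 * wedge v2 v1 * wedge v4 v1 * wedge v5 v3 =
     wedge v2 v3 * wedge v2 v6 * wedge v4 v6 * wedge v3 v1 * wedge v5 v1 * wedge v5 v4"
    using a by simp
  \<comment> \<open>Three brackets are reversed on each side, so the signs agree.\<close>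
  then show ?thesis
    by (simp add: wedge_commute[of v2 v1] wedge_commute[of v4 v1] wedge_commute[of v5 v3]
      wedge_commute[of v3 v1] wedge_commute[of v5 v1] wedge_commute[of v5 v4] mult_ac)
qed

text \<open>The rows of \<open>R\<close> below are coordinates dual, up to scale, to the chords 23, 34, 45; hence \<open>Q\<close>
  vanishes on these chords once \<open>S\<close> has zero diagonal.  Its off-diagonal entries \<open>(p, q, r)\<close>
  are a cross product, solving the two linear conditions from the chords 12 and 56.\<close>

lemma pairing_through_five_chords:
  fixes v1 v2 v3 v4 v5 v6 :: "'a::field_char_0 ^ 2"
  assumes n: "wedge v1 v4 \<noteq> 0" "wedge v1 v5 \<noteq> 0" "wedge v2 v3 \<noteq> 0" "wedge v2 v4 \<noteq> 0"
      "wedge v2 v5 \<noteq> 0" "wedge v2 v6 \<noteq> 0" "wedge v3 v4 \<noteq> 0" "wedge v3 v5 \<noteq> 0"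
      "wedge v3 v6 \<noteq> 0" "wedge v4 v5 \<noteq> 0"
    and nonconcurrent: "wedge v1 v4 * wedge v2 v4 * wedge v5 v3 * wedge v6 v3 \<noteq>
      wedge v1 v3 * wedge v2 v3 * wedge v5 v4 * wedge v6 v4"
  obtains Q where "transpose Q = Q" "det Q \<noteq> 0"
    "pairing Q v1 v2 = 0" "pairing Q v2 v3 = 0" "pairing Q v3 v4 = 0" "pairing Q v4 v5 = 0"
    "pairing Q v5 v6 = 0"
proof -
  define D where "D = wedge v2 v4 * wedge v5 v3 - wedge v2 v3 * wedge v5 v4"
  \<comment> \<open>On the chords 12 and 56 the middle coordinate \<open>G\<close> below equals
    [13][24] D and [53][64] D. Cancelling 2 [13][24] from the condition for 12 leaves D ([14][24] p
    + [13][23] q) + [14][23] r = 0, and similarly for 56. The cross product of the coefficient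
    vectors, divided by D, is (p, q, r).\<close>
  define p where "p = wedge v2 v3 * wedge v6 v3 * (wedge v1 v3 * wedge v5 v4 - wedge v1 v4 * wedge v5 v3)"
  define q where "q = wedge v1 v4 * wedge v5 v4 * (wedge v2 v3 * wedge v6 v4 - wedge v2 v4 * wedge v6 v3)"
  define r where "r = D * (wedge v1 v4 * wedge v2 v4 * wedge v5 v3 * wedge v6 v3 -
    wedge v1 v3 * wedge v2 v3 * wedge v5 v4 * wedge v6 v4)"
  \<comment> \<open>Chosen so that \<open>G\<close> vanishes on the chords 23 and 45. The outer
    coordinates vanish on chords through \<open>v4\<close> and \<open>v3\<close> respectively, so
    each of 23, 34, 45 has at most one nonzero coordinate.\<close>
  define s where "s = wedge v2 v4 * wedge v5 v3"
  define t where "t = - wedge v2 v4 * wedge v5 v4"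
  define u where "u = - wedge v2 v3 * wedge v5 v3"
  \<comment> \<open>The polarization of \<open>veronese\<close> at \<open>v3\<close> and
    \<open>v4\<close>.\<close>
  define \<sigma> :: "'a ^ 3" where
    "\<sigma> = vector [2 * (v3 $ 1 * v4 $ 1), v3 $ 1 * v4 $ 2 + v3 $ 2 * v4 $ 1, 2 * (v3 $ 2 * v4 $ 2)]"
  define R :: "'a ^ 3 ^ 3" where
    "R = vector [veronese v4, s *s \<sigma> + t *s veronese v3 + u *s veronese v4, veronese v3]"
  define S :: "'a ^ 3 ^ 3" where
    "S = vector [vector [0, p, r], vector [p, 0, q], vector [r, q, 0]]"
  define Q where "Q = transpose R ** S ** R"
  \<comment> \<open>These factor D, p and q into brackets, which shows that they are nonzero; for r,
    \<open>nonconcurrent\<close> supplies the remaining factor.\<close>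
  have plucker: "D = - (wedge v2 v5 * wedge v3 v4)"
      "wedge v1 v3 * wedge v5 v4 - wedge v1 v4 * wedge v5 v3 = wedge v1 v5 * wedge v3 v4"
      "wedge v2 v3 * wedge v6 v4 - wedge v2 v4 * wedge v6 v3 = wedge v2 v6 * wedge v3 v4"
    by (simp_all add: D_def wedge_def algebra_simps)
  have signs: "wedge v6 v3 \<noteq> 0" "wedge v5 v4 \<noteq> 0" "wedge v5 v3 \<noteq> 0"
    using n wedge_commute[of v6 v3] wedge_commute[of v5 v4] wedge_commute[of v5 v3] by auto
  have D0: "D \<noteq> 0" using n plucker(1) by auto
  have pqr: "p \<noteq> 0" "q \<noteq> 0" "r \<noteq> 0"
    using n signs D0 nonconcurrent unfolding p_def q_def r_def plucker(2,3) by auto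
  have "transpose S = S"
    by (simp add: S_def transpose_def vec_eq_iff forall_3)
  then have symQ: "transpose Q = Q"
    by (simp add: Q_def matrix_transpose_mul matrix_mul_assoc)
  \<comment> \<open>The t and u terms are multiples of the other two rows, so only the term with s
    contributes.\<close>
  have detR: "det R = - (s * wedge v3 v4 ^ 3)"
    unfolding det_3 R_def
    by (simp add: \<sigma>_def veronese_def wedge_def algebra_simps power2_eq_square power3_eq_cube)
  have detS: "det S = 2 * (p * q * r)"
    by (simp add: det_3 S_def algebra_simps)
  have detQ: "det Q \<noteq> 0"
    using detR n signs pqr by (simp add: Q_def det_mul detS s_def)
  define G where "G x y = s * (wedge x v3 * wedge y v4 + wedge x v4 * wedge y v3)
    + t * (wedge x v3 * wedge y v3) + u * (wedge x v4 * wedge y v4)" for x y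
  have Rform: "R *v root_form x y = vector [wedge x v4 * wedge y v4, G x y, wedge x v3 * wedge y v3]" for x y
    by (rule vec3_eqI)
      (simp_all add: R_def matrix_vector_mult_def sum_3 G_def root_form_def wedge_def \<sigma>_def
        veronese_def power2_eq_square algebra_simps)
  have F: "pairing Q x y = 2 * (p * (wedge x v4 * wedge y v4) * G x y
      + q * (wedge x v3 * wedge y v3) * G x y
      + r * (wedge x v4 * wedge y v4) * (wedge x v3 * wedge y v3))" for x y
  proof -
    have "pairing Q x y = scalar_product (R *v root_form x y) (S *v (R *v root_form x y))"
      by (simp only: pairing_def Q_def scalar_product_transpose matrix_vector_mul_assoc matrix_mul_assoc)
    then show ?thesis
      unfolding Rform
      by (simp add: S_def scalar_product_def sum_3 matrix_vector_mult_def algebra_simps)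
  qed
  \<comment> \<open>Both are polynomial identities with the brackets as independent
    variables.\<close>
  have "pairing Q v1 v2 = 0" unfolding F G_def p_def q_def r_def s_def t_def u_def D_def by algebra
  moreover have "pairing Q v5 v6 = 0" unfolding F G_def p_def q_def r_def s_def t_def u_def D_def by algebra
  moreover have "pairing Q v2 v3 = 0"
    unfolding F G_def s_def t_def u_def by (simp add: wedge_commute[of v4 v3])
  moreover have "pairing Q v3 v4 = 0" unfolding F by simp
  moreover have "pairing Q v4 v5 = 0"
    unfolding F G_def s_def t_def u_def by simp
  ultimately show ?thesis using that symQ detQ by blast
qed

section \<open>The conic and the seventh vertex from the equation\<close>

lemma pairing_parallel_zero:
  assumes "pairing Q u z = 0" "wedge z v = 0" "z \<noteq> 0"
  shows "pairing Q u v = 0"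
proof -
  obtain c where "v = c *s z" using assms(2,3) wedge_eq_0_imp_smult by blast
  then have "pairing Q u v = c * (c * pairing Q u z)"
    by (simp add: pairing_def matrix_vector_smult scalar_product_smult)
  with assms(1) show ?thesis by simp
qed

text \<open>Concurrency would reduce the equation to [12][56] = [15][26]. By the Pluecker relation
  this means [16][25] = 0, contradicting distinctness.\<close>

lemma chords_nonconcurrent:
  fixes v1 v2 v3 v4 v5 v6 :: "'a::field ^ 2"
  assumes eq: "wedge v3 v6 * wedge v2 v4 * wedge v5 v6 * wedge v3 v5 * wedge v1 v2 * wedge v1 v4 =
         wedge v1 v3 * wedge v4 v5 * wedge v2 v6 * wedge v1 v5 * wedge v4 v6 * wedge v2 v3"
    and nz: "wedge v1 v3 \<noteq> 0" "wedge v2 v3 \<noteq> 0" "wedge v4 v5 \<noteq> 0" "wedge v4 v6 \<noteq> 0"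
      "wedge v1 v6 \<noteq> 0" "wedge v2 v5 \<noteq> 0"
  shows "wedge v1 v4 * wedge v2 v4 * wedge v5 v3 * wedge v6 v3 \<noteq>
    wedge v1 v3 * wedge v2 v3 * wedge v5 v4 * wedge v6 v4"
proof
  define X where "X = wedge v1 v3 * wedge v2 v3 * wedge v4 v5 * wedge v4 v6"
  assume "wedge v1 v4 * wedge v2 v4 * wedge v5 v3 * wedge v6 v3 =
    wedge v1 v3 * wedge v2 v3 * wedge v5 v4 * wedge v6 v4"
  then have X: "wedge v1 v4 * wedge v2 v4 * wedge v3 v5 * wedge v3 v6 = X"
    by (simp add: X_def wedge_commute[of v5] wedge_commute[of v6])
  have "X * (wedge v1 v2 * wedge v5 v6) =
      wedge v3 v6 * wedge v2 v4 * wedge v5 v6 * wedge v3 v5 * wedge v1 v2 * wedge v1 v4"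
    unfolding X[symmetric] by (simp add: mult_ac)
  also have "\<dots> = X * (wedge v1 v5 * wedge v2 v6)"
    unfolding eq X_def by (simp add: mult_ac)
  finally have "X * (wedge v1 v2 * wedge v5 v6) = X * (wedge v1 v5 * wedge v2 v6)" .
  moreover have "X \<noteq> 0" using nz by (simp add: X_def)
  ultimately have "wedge v1 v2 * wedge v5 v6 = wedge v1 v5 * wedge v2 v6" by simp
  then have "wedge v1 v6 * wedge v2 v5 = 0" using wedge_plucker[of v1 v2 v5 v6] by simp
  then show False using nz by simp
qed

text \<open>The five chords determine the rows of 2 to 5, while those of 1 and 6 each have one
  unknown root. The equation makes these two roots the same point z, the seventh vertex.\<close>

lemma heptagon_pairing_exists:
  fixes v :: "nat \<Rightarrow> 'a::field_char_0 ^ 2"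
  assumes distinct: "\<And>i j. \<lbrakk>i \<in> {1..6}; j \<in> {1..6}; i \<noteq> j\<rbrakk> \<Longrightarrow> wedge (v i) (v j) \<noteq> 0"
    and eq: "wedge (v 3) (v 6) * wedge (v 2) (v 4) * wedge (v 5) (v 6) *
        wedge (v 3) (v 5) * wedge (v 1) (v 2) * wedge (v 1) (v 4) =
      wedge (v 1) (v 3) * wedge (v 4) (v 5) * wedge (v 2) (v 6) *
        wedge (v 1) (v 5) * wedge (v 4) (v 6) * wedge (v 2) (v 3)"
  obtains Q z where "transpose Q = Q" "det Q \<noteq> 0" "z \<noteq> 0"
    "\<And>i. i \<in> {1..5} \<Longrightarrow> pairing Q (v i) (v (i + 1)) = 0"
    "pairing Q (v 6) z = 0" "pairing Q z (v 1) = 0" "\<And>i. i \<in> {1..6} \<Longrightarrow> wedge z (v i) \<noteq> 0"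
proof -
  have nz: "v i \<noteq> 0" if "i \<in> {1..6}" for i
    using that distinct[of 1 2] distinct[of i 1] by (cases "i = 1") auto
  have d: "wedge (v i) (v j) \<noteq> 0" if "i \<in> set [1, 2, 3, 4, 5, 6]" "j \<in> set [1, 2, 3, 4, 5, 6]" "i \<noteq> j" for i j
    using that by (intro distinct) auto
  obtain Q where Q: "transpose Q = Q" "det Q \<noteq> 0"
    and q: "pairing Q (v 1) (v 2) = 0" "pairing Q (v 2) (v 3) = 0" "pairing Q (v 3) (v 4) = 0"
      "pairing Q (v 4) (v 5) = 0" "pairing Q (v 5) (v 6) = 0"
    by (rule pairing_through_five_chords[of "v 1" "v 4" "v 5" "v 2" "v 3" "v 6"])
      (use d chords_nonconcurrent[OF eq] in auto)
  have row: "\<exists>k. k \<noteq> 0 \<and> (\<forall>y. pairing Q b y = k * wedge a y * wedge c y)"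
    if abc: "pairing Q a b = 0" "pairing Q b c = 0" "wedge a c \<noteq> 0" "b \<noteq> 0" for a b c
  proof -
    have "pairing Q b a = 0" using abc(1) by (simp only: pairing_commute[of Q b a])
    then obtain k where k: "\<And>y. pairing Q b y = k * wedge a y * wedge c y"
      using pairing_row_two_roots[of Q b a c] abc by blast
    obtain y where "pairing Q b y \<noteq> 0" using pairing_row_nonzero[OF Q] abc by blast
    then have "k \<noteq> 0" using k by auto
    with k show ?thesis by blast
  qed
  obtain a2 where a2: "a2 \<noteq> 0" "\<And>y. pairing Q (v 2) y = a2 * wedge (v 1) y * wedge (v 3) y"
    using row[OF q(1,2)] d nz by auto
  obtain a3 where a3: "a3 \<noteq> 0" "\<And>y. pairing Q (v 3) y = a3 * wedge (v 2) y * wedge (v 4) y"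
    using row[OF q(2,3)] d nz by auto
  obtain a4 where a4: "a4 \<noteq> 0" "\<And>y. pairing Q (v 4) y = a4 * wedge (v 3) y * wedge (v 5) y"
    using row[OF q(3,4)] d nz by auto
  obtain a5 where a5: "a5 \<noteq> 0" "\<And>y. pairing Q (v 5) y = a5 * wedge (v 4) y * wedge (v 6) y"
    using row[OF q(4,5)] d nz by auto
  have "v 2 \<noteq> 0" "v 5 \<noteq> 0" using nz by auto
  then obtain w z where w: "\<And>y. pairing Q (v 1) y = wedge (v 2) y * wedge w y"
    and z: "\<And>y. pairing Q (v 6) y = wedge (v 5) y * wedge z y"
    using q pairing_row_residual pairing_commute by metis
  have "v 1 \<noteq> 0" "v 6 \<noteq> 0" using nz by auto
  then have wz0: "w \<noteq> 0" "z \<noteq> 0"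
    using w z pairing_row_nonzero[OF Q] by (metis mult_zero_right wedge_zero(1))+
  have e13: "wedge (v 2) (v 3) * wedge w (v 3) = a3 * wedge (v 2) (v 1) * wedge (v 4) (v 1)"
    using pairing_commute[of Q "v 1" "v 3"] unfolding w a3(2) .
  have e14: "wedge (v 2) (v 4) * wedge w (v 4) = a4 * wedge (v 3) (v 1) * wedge (v 5) (v 1)"
    using pairing_commute[of Q "v 1" "v 4"] unfolding w a4(2) .
  have e63: "wedge (v 5) (v 3) * wedge z (v 3) = a3 * wedge (v 2) (v 6) * wedge (v 4) (v 6)"
    using pairing_commute[of Q "v 6" "v 3"] unfolding z a3(2) .
  have e64: "wedge (v 5) (v 4) * wedge z (v 4) = a4 * wedge (v 3) (v 6) * wedge (v 5) (v 6)"
    using pairing_commute[of Q "v 6" "v 4"] unfolding z a4(2) .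
  \<comment> \<open>The equation enters as a comparison of the products of \<open>e13\<close> with
    \<open>e64\<close> and of \<open>e14\<close> with \<open>e63\<close>; \<open>?C\<close> is the
    nonzero common factor.\<close>
  let ?C = "wedge (v 2) (v 3) * wedge (v 2) (v 4) * wedge (v 5) (v 3) * wedge (v 5) (v 4)"
  have "?C * (wedge w (v 3) * wedge z (v 4)) =
      (wedge (v 2) (v 3) * wedge w (v 3)) * (wedge (v 5) (v 4) * wedge z (v 4)) *
      (wedge (v 2) (v 4) * wedge (v 5) (v 3))"
    by (simp add: mult_ac)
  also have "\<dots> = a3 * a4 * (wedge (v 3) (v 6) * wedge (v 2) (v 4) * wedge (v 5) (v 6) *
        wedge (v 5) (v 3) * wedge (v 2) (v 1) * wedge (v 4) (v 1))"
    unfolding e13 e64 by (simp add: mult_ac)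
  also have "\<dots> = a3 * a4 * (wedge (v 3) (v 1) * wedge (v 5) (v 4) * wedge (v 2) (v 6) *
        wedge (v 5) (v 1) * wedge (v 4) (v 6) * wedge (v 2) (v 3))"
    using eq by (simp only: wedge_commute[of "v 5" "v 3"] wedge_commute[of "v 2" "v 1"]
        wedge_commute[of "v 4" "v 1"] wedge_commute[of "v 3" "v 1"] wedge_commute[of "v 5" "v 1"]
        wedge_commute[of "v 5" "v 4"] mult_minus_left mult_minus_right)
  also have "\<dots> = (wedge (v 2) (v 4) * wedge w (v 4)) * (wedge (v 5) (v 3) * wedge z (v 3)) *
      (wedge (v 2) (v 3) * wedge (v 5) (v 4))"
    unfolding e14 e63 by (simp add: mult_ac)
  also have "\<dots> = ?C * (wedge w (v 4) * wedge z (v 3))"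
    by (simp add: mult_ac)
  finally have "wedge w (v 3) * wedge z (v 4) = wedge w (v 4) * wedge z (v 3)"
    using d by simp
  \<comment> \<open>The Pluecker relation turns equality of the mixed products into parallelism of w
    and z.\<close>
  then have "wedge w z * wedge (v 3) (v 4) = 0"
    using wedge_plucker[of w z "v 3" "v 4"] by simp
  then have wz: "wedge w z = 0" using d by simp
  have z1: "pairing Q (v 1) z = 0" and z6: "pairing Q (v 6) z = 0"
    unfolding w z by (simp_all only: wz wedge_self mult_zero_right)
  \<comment> \<open>If z were point i, then 1 and 6 would both be roots of row i. For i from 2 to 5
    the roots are the two neighbours, which never are 1 and 6; for i = 1 or 6 the points 1 and 6
    would coincide.\<close>
  have distinct_z: "wedge z (v i) \<noteq> 0" if i: "i \<in> {1..6}" for i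
  proof
    assume par: "wedge z (v i) = 0"
    have p1: "pairing Q (v i) (v 1) = 0" and p6: "pairing Q (v i) (v 6) = 0"
      using pairing_parallel_zero[OF z1 par wz0(2)] pairing_parallel_zero[OF z6 par wz0(2)]
      by (simp_all add: pairing_commute[of Q "v i"])
    consider "i = 1" | "i = 6" | "i = 2" | "i = 3" | "i = 4" | "i = 5" using i by force
    then show False
    proof cases
      case 1
      obtain c where c: "z = c *s w" using wz wz0 wedge_eq_0_imp_smult by blast
      have "wedge w (v 6) = 0" using p6 d w[of "v 6"] 1 by simp
      then have "wedge z (v 6) = 0" by (simp add: c wedge_def algebra_simps)
      then obtain a where a: "v 6 = a *s z" using wz0 wedge_eq_0_imp_smult by blast
      obtain b where b: "v 1 = b *s z" using par 1 wz0 wedge_eq_0_imp_smult by blast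
      have "wedge (v 1) (v 6) = 0" unfolding a b by (simp add: wedge_def)
      then show False using d by simp
    next
      case 2
      have "wedge z (v 1) = 0" using p1 d z[of "v 1"] 2 by simp
      then obtain a where a: "v 1 = a *s z" using wz0 wedge_eq_0_imp_smult by blast
      obtain b where b: "v 6 = b *s z" using par 2 wz0 wedge_eq_0_imp_smult by blast
      have "wedge (v 1) (v 6) = 0" unfolding a b by (simp add: wedge_def)
      then show False using d by simp
    next
      case 3
      then show False using p6 a2 d by auto
    next
      case 4
      then show False using p6 a3 d by auto
    next
      case 5
      then show False using p1 a4 d by auto
    next
      case 6
      then show False using p1 a5 d by auto
    qed
  qed
  have "pairing Q (v i) (v (i + 1)) = 0" if "i \<in> {1..5}" for i
  proof -
    have "i = 1 \<or> i = 2 \<or> i = 3 \<or> i = 4 \<or> i = 5" using that by auto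
    then show ?thesis using q by (auto simp: numeral_eq_Suc)
  qed
  then show ?thesis
    using z1 by (intro that[OF Q wz0(2) _ z6 _ distinct_z]) (simp_all add: pairing_commute[of Q z])
qed

section \<open>Indices modulo seven\<close>

lemma mod_add_neq:
  fixes j m n :: nat
  assumes "0 < j" "j < m"
  shows "n mod m \<noteq> (n + j) mod m"
proof
  assume "n mod m = (n + j) mod m"
  then have "(n + j) mod m = n mod m" by simp
  then have "m dvd j" by (simp add: mod_eq_dvd_iff_nat)
  then show False using assms dvd_imp_le by fastforce
qed

lemma period_7_eq_imp_mod_eq:
  fixes h :: "nat \<Rightarrow> 'b"
  assumes "\<And>i. i \<ge> 1 \<Longrightarrow> h (i + 7) = h i" "inj_on h {1..7}" "a \<ge> 1" "b \<ge> 1" "h a = h b"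
  shows "a mod 7 = b mod 7"
proof -
  have period: "h (m + 7 * n) = h m" if "m \<ge> 1" for m n
  proof (induction n)
    case (Suc n)
    then show ?case using assms(1)[of "m + 7 * n"] that by (simp add: algebra_simps)
  qed simp
  \<comment> \<open>The shift by one keeps the reduced index within 1 to 7; periodicity says nothing
    about index 0.\<close>
  have reduce: "h i = h (1 + (i - 1) mod 7)" if "i \<ge> 1" for i
    using period[of "1 + (i - 1) mod 7" "(i - 1) div 7"] that by simp
  have "h (1 + (a - 1) mod 7) = h (1 + (b - 1) mod 7)"
    using reduce assms by metis
  moreover have "1 + (i - 1) mod 7 \<in> {1..7}" for i :: nat
    using mod_less_divisor[of 7 "i - 1"] by (simp del: mod_less_divisor)
  ultimately have "1 + (a - 1) mod 7 = 1 + (b - 1) mod 7"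
    using assms(2) by (meson inj_onD)
  then have "Suc (a - 1) mod 7 = Suc (b - 1) mod 7"
    by (metis mod_Suc_eq plus_1_eq_Suc)
  then show ?thesis using assms(3,4) by simp
qed

section \<open>The two directions of the equivalence\<close>

context parametrized_conic
begin

lemma heptagon_imp_equation:
  assumes distinct: "\<And>i j. \<lbrakk>i \<in> {1..6}; j \<in> {1..6}; i \<noteq> j\<rbrakk> \<Longrightarrow> wedge (v i) (v j) \<noteq> 0"
    and h: "proper_poncelet_polygon 7 A h" "\<And>i. i \<in> {1..6} \<Longrightarrow> h (k + i) = \<phi> (proj (v i))"
  shows "wedge (v 3) (v 6) * wedge (v 2) (v 4) * wedge (v 5) (v 6) *
        wedge (v 3) (v 5) * wedge (v 1) (v 2) * wedge (v 1) (v 4) =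
      wedge (v 1) (v 3) * wedge (v 4) (v 5) * wedge (v 2) (v 6) *
        wedge (v 1) (v 5) * wedge (v 4) (v 6) * wedge (v 2) (v 3)"
proof -
  have nz: "v i \<noteq> 0" if "i \<in> {1..6}" for i
    using that distinct[of 1 2] distinct[of i 1] by (cases "i = 1") auto
  obtain B l where B: "nondegenerate_conic B" and chain: "poncelet_chain A B h l"
    and per: "\<And>i. i \<ge> 1 \<Longrightarrow> h (i + 7) = h i" and inj: "inj_on h {1..7}"
    using h(1) unfolding proper_poncelet_polygon_def poncelet_polygon_def by blast
  have "h (k + 7) \<in> conic_points A"
    using chain unfolding poncelet_chain_def by simp
  then obtain z where z: "z \<noteq> 0" "h (k + 7) = \<phi> (proj z)" using point_exhaust by blast
  \<comment> \<open>Properness and period 7 separate the seventh vertex from the other six.\<close>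
  have dz: "wedge z (v i) \<noteq> 0" if i: "i \<in> {1..6}" for i
  proof
    assume "wedge z (v i) = 0"
    then have "h (k + 7) = h (k + i)" using z i nz h(2) point_eq_iff by simp
    moreover have i': "i \<ge> 1" "i \<le> 6" using i by auto
    ultimately have "(k + 7) mod 7 = (k + i) mod 7" using period_7_eq_imp_mod_eq[OF per inj, of "k + 7" "k + i"] by simp
    then show False using mod_add_neq[of i 7 k] i' by simp
  qed
  have d: "wedge (v i) (v j) \<noteq> 0" if "i \<in> set [1, 2, 3, 4, 5, 6]" "j \<in> set [1, 2, 3, 4, 5, 6]" "i \<noteq> j" for i j
    using that by (intro distinct) auto
  have dz': "wedge (v i) z \<noteq> 0" if "i \<in> {1..6}" for i
    using dz[OF that] wedge_eq_0_commute[of z "v i"] by blast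
  \<comment> \<open>The row of \<open>v 1\<close> is taken one period later, at index k + 8: its
    predecessor at k would be the irrelevant index 0 when \<open>k = 0\<close>.\<close>
  have k8: "k + 8 = (k + 1) + 7" and k9: "k + 9 = (k + 2) + 7" by simp_all
  have "h (k + 8) = h (k + 1)" "h (k + 9) = h (k + 2)"
    unfolding k8 k9 by (rule per; simp)+
  then have p: "h (k + 8) = \<phi> (proj (v 1))" "h (k + 9) = \<phi> (proj (v 2))"
    "h (k + 2) = \<phi> (proj (v 2))" "h (k + 3) = \<phi> (proj (v 3))" "h (k + 4) = \<phi> (proj (v 4))"
    "h (k + 5) = \<phi> (proj (v 5))" "h (k + 6) = \<phi> (proj (v 6))"
    by (simp_all only:) (rule h(2); simp)+
  obtain Q where Q: "\<And>i u w z. \<lbrakk>i \<ge> 1; h i = \<phi> (proj u); h (i + 1) = \<phi> (proj w);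
       h (i + 2) = \<phi> (proj z); wedge u w \<noteq> 0; wedge w z \<noteq> 0; wedge u z \<noteq> 0\<rbrakk>
     \<Longrightarrow> \<exists>c. c \<noteq> 0 \<and> (\<forall>y. pairing Q w y = c * wedge u y * wedge z y)"
    using chain_rows[OF B chain] by blast
  have step: "\<exists>c. c \<noteq> 0 \<and> (\<forall>y. pairing Q w y = c * wedge u y * wedge z y)"
    if "i \<ge> 1" "h (k + i) = \<phi> (proj u)" "h (k + (i + 1)) = \<phi> (proj w)"
      "h (k + (i + 2)) = \<phi> (proj z)" "wedge u w \<noteq> 0" "wedge w z \<noteq> 0" "wedge u z \<noteq> 0" for i u w z
    by (rule Q[of "k + i"]) (use that in \<open>simp_all only: add.assoc trans_le_add2 not_False_eq_True\<close>)
  obtain a1 where a1: "a1 \<noteq> 0" "\<And>y. pairing Q (v 1) y = a1 * wedge z y * wedge (v 2) y"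
    using step[of 7 z "v 1" "v 2"] z p dz d by auto
  obtain a3 where a3: "a3 \<noteq> 0" "\<And>y. pairing Q (v 3) y = a3 * wedge (v 2) y * wedge (v 4) y"
    using step[of 2 "v 2" "v 3" "v 4"] p d by auto
  obtain a4 where a4: "a4 \<noteq> 0" "\<And>y. pairing Q (v 4) y = a4 * wedge (v 3) y * wedge (v 5) y"
    using step[of 3 "v 3" "v 4" "v 5"] p d by auto
  obtain a6 where a6: "a6 \<noteq> 0" "\<And>y. pairing Q (v 6) y = a6 * wedge (v 5) y * wedge z y"
    using step[of 5 "v 5" "v 6" z] z p dz' d by auto
  show ?thesis
    using dz by (intro heptagon_equation_of_rows[OF a1(1) a3(1) a4(1) a6(1) a1(2) a3(2) a4(2) a6(2)]) auto
qed

lemma equation_imp_heptagon: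
  assumes distinct: "\<And>i j. \<lbrakk>i \<in> {1..6}; j \<in> {1..6}; i \<noteq> j\<rbrakk> \<Longrightarrow> wedge (v i) (v j) \<noteq> 0"
    and eq: "wedge (v 3) (v 6) * wedge (v 2) (v 4) * wedge (v 5) (v 6) *
        wedge (v 3) (v 5) * wedge (v 1) (v 2) * wedge (v 1) (v 4) =
      wedge (v 1) (v 3) * wedge (v 4) (v 5) * wedge (v 2) (v 6) *
        wedge (v 1) (v 5) * wedge (v 4) (v 6) * wedge (v 2) (v 3)"
  shows "\<exists>h. proper_poncelet_polygon 7 A h \<and> (\<forall>i\<in>{1..6}. h i = \<phi> (proj (v i)))"
proof -
  obtain Q z where Q: "transpose Q = Q" "det Q \<noteq> 0" "z \<noteq> 0"
    and q: "\<And>i. i \<in> {1..5} \<Longrightarrow> pairing Q (v i) (v (i + 1)) = 0"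
      "pairing Q (v 6) z = 0" "pairing Q z (v 1) = 0"
    and dz: "\<And>i. i \<in> {1..6} \<Longrightarrow> wedge z (v i) \<noteq> 0"
    using heptagon_pairing_exists[OF distinct eq] by blast
  \<comment> \<open>The residue 0 stands for the seventh vertex, so that \<open>V\<close> agrees
    with v on 1 to 6 and has period 7 on all indices.\<close>
  define V where "V n = (if n mod 7 = 0 then z else v (n mod 7))" for n :: nat
  have dV: "wedge (V m) (V n) \<noteq> 0" if neq: "m mod 7 \<noteq> n mod 7" for m n
  proof -
    have mem: "n mod 7 \<in> {1..6}" if "n mod 7 \<noteq> 0" for n :: nat
      using that mod_less_divisor[of 7 n] by (simp del: mod_less_divisor)
    have dz': "wedge (v i) z \<noteq> 0" if "i \<in> {1..6}" for i
      using dz[OF that] wedge_eq_0_commute[of z "v i"] by blast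
    consider "m mod 7 = 0" "n mod 7 \<noteq> 0" | "m mod 7 \<noteq> 0" "n mod 7 = 0"
      | "m mod 7 \<noteq> 0" "n mod 7 \<noteq> 0" using neq by metis
    then show ?thesis
    proof cases
      case 1
      then show ?thesis using dz[OF mem[OF 1(2)]] 1 by (simp only: V_def if_True if_False not_False_eq_True)
    next
      case 2
      then show ?thesis using dz'[OF mem[OF 2(1)]] 2 by (simp only: V_def if_True if_False not_False_eq_True)
    next
      case 3
      then show ?thesis using distinct[OF mem[OF 3(1)] mem[OF 3(2)] neq] 3 by (simp only: V_def if_False not_False_eq_True)
    qed
  qed
  have "pairing Q (V n) (V (n + 1)) = 0" for n
  proof -
    have succ: "(n + 1) mod 7 = (if n mod 7 = 6 then 0 else n mod 7 + 1)"
      by (simp add: mod_Suc)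
    consider "n mod 7 = 0" | "n mod 7 = 6" | "n mod 7 \<in> {1..5}"
      using mod_less_divisor[of 7 n] by (force simp del: mod_less_divisor)
    then show ?thesis
    proof cases
      case 1
      then show ?thesis using q(3) succ by (simp add: V_def)
    next
      case 2
      then show ?thesis using q(2) succ by (simp add: V_def)
    next
      case 3
      then have "V n = v (n mod 7)" "V (n + 1) = v (n mod 7 + 1)"
        unfolding V_def succ by (simp_all)
      then show ?thesis using q(1)[OF 3] by simp
    qed
  qed
  moreover have "wedge (V n) (V (n + 1)) \<noteq> 0" "wedge (V n) (V (n + 2)) \<noteq> 0" for n
    by (rule dV, rule mod_add_neq; simp)+
  ultimately obtain B l where Bl: "nondegenerate_conic B" "poncelet_chain A B (\<lambda>n. \<phi> (proj (V n))) l"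
    using chain_of_pairing[OF Q(1,2)] by blast
  have nzV: "V n \<noteq> 0" for n
  proof -
    have "n mod 7 \<noteq> (n + 1) mod 7" by (rule mod_add_neq) simp_all
    then show ?thesis using dV[of n "n + 1"] by auto
  qed
  have "inj_on (\<lambda>n. \<phi> (proj (V n))) {1..7}"
  proof (rule inj_onI)
    fix m n :: nat
    assume mn: "m \<in> {1..7}" "n \<in> {1..7}" and "\<phi> (proj (V m)) = \<phi> (proj (V n))"
    then have "m mod 7 = n mod 7" using point_eq_iff nzV dV by blast
    moreover have "x mod 7 = (if x = 7 then 0 else x)" if "x \<in> {1..7}" for x :: nat
      using that by auto
    ultimately have "(if m = 7 then 0 else m) = (if n = 7 then 0 else n)"
      using mn by metis
    then show "m = n" using mn by (auto split: if_splits)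
  qed
  moreover have "V (n + 7) = V n" for n by (simp add: V_def)
  ultimately have "proper_poncelet_polygon 7 A (\<lambda>n. \<phi> (proj (V n)))"
    using Bl unfolding proper_poncelet_polygon_def poncelet_polygon_def by auto
  moreover have "V i = v i" if "i \<in> {1..6}" for i using that by (simp add: V_def)
  ultimately show ?thesis by (intro exI[of _ "\<lambda>n. \<phi> (proj (V n))"]) simp
qed

end

text \<open>Proved over an arbitrary field of characteristic 0, so that the real and the complex
  case are both instances.\<close>

lemma heptagon_iff:
  fixes A :: "'a::field_char_0 ^ 3 ^ 3"
  assumes inj: "inj_on p {1..6}" and par: "conic_parametrization A \<phi>"
    and v: "\<forall>i\<in>{1..6}. v i \<noteq> 0 \<and> \<phi> (proj (v i)) = p i"
  shows "(\<exists>h k. proper_poncelet_polygon 7 A h \<and> (\<forall>i\<in>{1..6}. p i = h (k + i))) \<longleftrightarrow>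
         bracket v 3 6 * bracket v 2 4 * bracket v 5 6 *
           bracket v 3 5 * bracket v 1 2 * bracket v 1 4 =
         bracket v 1 3 * bracket v 4 5 * bracket v 2 6 *
           bracket v 1 5 * bracket v 4 6 * bracket v 2 3"
proof -
  obtain M N where "M ** N = mat 1" "\<forall>v. v \<noteq> 0 \<longrightarrow> \<phi> (proj v) = proj (M *v veronese v)"
    and "bij_betw \<phi> UNIV (conic_points A)"
    using par unfolding conic_parametrization_def invertible_def by blast
  then interpret parametrized_conic A \<phi> M N
    by unfold_locales auto
  have distinct: "wedge (v i) (v j) \<noteq> 0" if "i \<in> {1..6}" "j \<in> {1..6}" "i \<noteq> j" for i j
    using that v inj point_eq_iff[of "v i" "v j"] by (metis inj_onD)
  show ?thesis
    unfolding bracket_eq_wedge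
  proof
    assume "\<exists>h k. proper_poncelet_polygon 7 A h \<and> (\<forall>i\<in>{1..6}. p i = h (k + i))"
    then obtain h k where h: "proper_poncelet_polygon 7 A h" "\<forall>i\<in>{1..6}. p i = h (k + i)"
      by blast
    show "wedge (v 3) (v 6) * wedge (v 2) (v 4) * wedge (v 5) (v 6) *
        wedge (v 3) (v 5) * wedge (v 1) (v 2) * wedge (v 1) (v 4) =
      wedge (v 1) (v 3) * wedge (v 4) (v 5) * wedge (v 2) (v 6) *
        wedge (v 1) (v 5) * wedge (v 4) (v 6) * wedge (v 2) (v 3)"
      by (rule heptagon_imp_equation[OF distinct h(1)]) (use h(2) v in auto)
  next
    assume "wedge (v 3) (v 6) * wedge (v 2) (v 4) * wedge (v 5) (v 6) *
        wedge (v 3) (v 5) * wedge (v 1) (v 2) * wedge (v 1) (v 4) =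
      wedge (v 1) (v 3) * wedge (v 4) (v 5) * wedge (v 2) (v 6) *
        wedge (v 1) (v 5) * wedge (v 4) (v 6) * wedge (v 2) (v 3)"
    \<comment> \<open>The constructed heptagon starts with the given points, so the offset is
      \<open>k = 0\<close>.\<close>
    from equation_imp_heptagon[OF distinct this]
    show "\<exists>h k. proper_poncelet_polygon 7 A h \<and> (\<forall>i\<in>{1..6}. p i = h (k + i))"
      using v by (metis add_0)
  qed
qed

theorem theorem2:
  shows
    "(\<forall>(A :: real ^ 3 ^ 3) (p :: nat \<Rightarrow> real point) (\<phi> :: (real, 2) proj_space \<Rightarrow> real point)
        (v :: nat \<Rightarrow> real ^ 2).
        nondegenerate_conic A \<and>
        inj_on p {1..6} \<and> p ` {1..6} \<subseteq> conic_points A \<and>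
        conic_parametrization A \<phi> \<and>
        (\<forall>i\<in>{1..6}. v i \<noteq> 0 \<and> \<phi> (proj (v i)) = p i) \<longrightarrow>
        ((\<exists>h k. proper_poncelet_polygon 7 A h \<and> (\<forall>i\<in>{1..6}. p i = h (k + i))) \<longleftrightarrow>
         bracket v 3 6 * bracket v 2 4 * bracket v 5 6 *
           bracket v 3 5 * bracket v 1 2 * bracket v 1 4 =
         bracket v 1 3 * bracket v 4 5 * bracket v 2 6 *
           bracket v 1 5 * bracket v 4 6 * bracket v 2 3))
     \<and>
     (\<forall>(A :: complex ^ 3 ^ 3) (p :: nat \<Rightarrow> complex point)
        (\<phi> :: (complex, 2) proj_space \<Rightarrow> complex point) (v :: nat \<Rightarrow> complex ^ 2).
        nondegenerate_conic A \<and>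
        inj_on p {1..6} \<and> p ` {1..6} \<subseteq> conic_points A \<and>
        conic_parametrization A \<phi> \<and>
        (\<forall>i\<in>{1..6}. v i \<noteq> 0 \<and> \<phi> (proj (v i)) = p i) \<longrightarrow>
        ((\<exists>h k. proper_poncelet_polygon 7 A h \<and> (\<forall>i\<in>{1..6}. p i = h (k + i))) \<longleftrightarrow>
         bracket v 3 6 * bracket v 2 4 * bracket v 5 6 *
           bracket v 3 5 * bracket v 1 2 * bracket v 1 4 =
         bracket v 1 3 * bracket v 4 5 * bracket v 2 6 *
           bracket v 1 5 * bracket v 4 6 * bracket v 2 3))"
  by (intro conjI allI impI; elim conjE; rule heptagon_iff; assumption)

end
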